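(* Let $n\le m$, let $\mathcal{F}=[c_1,\ldots,c_n]$ be an $m\times n$-Ferrers diagram, let $2\leq\delta\leq n$ and $\ell=n-\delta+1$. Set $\varepsilon=\sum_{t=\ell+1}^n(m-c_t)$. Suppose $$c_t\leq c_{\ell+1}-\varepsilon(\ell+1-t)\quad\text{for } t=1,\ldots,\ell.$$ Let $G=(I_\ell\mid A)\in\mathbb{F}_{q^m}^{\ell\times n}$ be a generator matrix of an $\mathbb{F}_{q^m}$-linear $[m\times n;\delta]$-MRD code. Then there exists an ordered basis $B=(x_1,\ldots,x_m)$ of $\mathbb{F}_{q^m}$ over $\mathbb{F}_q$ such that the $\mathbb{F}_q$-subspace $$\mathcal{C}=\big\{\phi_B\big((u_1,\ldots,u_\ell)G\big)\,\big|\, u_t\in\langle x_1,\ldots,x_{c_t}\rangle_{\mathbb{F}_q}\text{ for }t=1,\ldots,\ell\big\}\subseteq\mathbb{F}_q^{m\times n}$$ is a maximal $[\mathcal{F};\delta]_q$-code. In this case $\nu_{\min}(\mathcal{F};\delta)=\nu_0(\mathcal{F};\delta)=\sum_{t=1}^\ell c_t$.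
   Context: $q$ is a prime power, $[n]=\{1,\ldots,n\}$. An $m\times n$-Ferrers diagram is a set $\mathcal{F}\subseteq[m]\times[n]$ such that $(i,j)\in\mathcal{F}$, $j<n$ implies $(i,j+1)\in\mathcal{F}$, and $(i,j)\in\mathcal{F}$, $i>1$ implies $(i-1,j)\in\mathcal{F}$. It is identified with $[c_1,\ldots,c_n]$, where $c_j$ is the number of elements of $\mathcal{F}$ in column $j$ (so $0\le c_1\le\dots\le c_n\le m$; $c_1=0$ and $c_n<m$ are allowed). A rank-metric code is an $\mathbb{F}_q$-subspace $\mathcal{C}$ of $\mathbb{F}_q^{m\times n}$ or of $\mathbb{F}_{q^m}^n$, where the rank of $(a_1,\ldots,a_n)\in\mathbb{F}_{q^m}^n$ is $\dim_{\mathbb{F}_q}\langle a_1,\ldots,a_n\rangle_{\mathbb{F}_q}$; its rank distance is the minimum rank of its nonzero elements. For $n\le m$, an $[m\times n;\delta]$-MRD code is a rank-metric code of $\mathbb{F}_q$-dimension $m(n-\delta+1)$ and rank distance $\delta$; it is called $\mathbb{F}_{q^m}$-linear if it is an $\mathbb{F}_{q^m}$-subspace of $\mathbb{F}_{q^m}^n$. A generator matrix of it is a matrix whose rows form an $\mathbb{F}_{q^m}$-basis of it. For an ordered basis $B$ of $\mathbb{F}_{q^m}$ over $\mathbb{F}_q$, $\phi_B:\mathbb{F}_{q^m}^n\to\mathbb{F}_q^{m\times n}$ maps $(a_1,\ldots,a_n)$ to the matrix whose $j$-th column is the coordinate vector of $a_j$ with respect to $B$. An $[\mathcal{F};\delta]_q$-code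 is a rank-metric code in $\mathbb{F}_q^{m\times n}$ with rank distance $\delta$ all of whose matrices have their nonzero entries only at positions in $\mathcal{F}$. For $j=0,\ldots,\delta-1$ put $\nu_j(\mathcal{F};\delta)=\sum_{t=1}^{n-\delta+1+j}\max\{c_t-j,0\}$ and $\nu_{\min}(\mathcal{F};\delta)=\min\{\nu_0,\ldots,\nu_{\delta-1}\}$. An $[\mathcal{F};\delta]_q$-code is maximal if its dimension is $\nu_{\min}(\mathcal{F};\delta)$. In the degenerate case $\nu_{\min}(\mathcal{F};\delta)=0$ the zero code is regarded as a (maximal) $[\mathcal{F};\delta]_q$-code. *)

theory Defs
  imports "Jordan_Normal_Form.DL_Rank" "HOL-Library.Cardinality"
begin

text \<open>The extension \<open>F\<^sub>q \<subseteq> F\<^sub>q\<^sup>m\<close> is given by two finite fields \<open>'q\<close>, \<open>'l\<close> and an embedding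
  \<open>\<iota> :: 'q \<Rightarrow> 'l\<close>, with \<open>CARD('l) = CARD('q) ^ m\<close>.\<close>

definition ext_scale :: "('q::field \<Rightarrow> 'l::field) \<Rightarrow> 'q \<Rightarrow> 'l \<Rightarrow> 'l" where
  "ext_scale \<iota> c x = \<iota> c * x"

lemma vector_space_ext_scale:
  assumes "field_hom \<iota>"
  shows "Vector_Spaces.vector_space (ext_scale \<iota>)"
proof -
  interpret field_hom \<iota> by fact
  show ?thesis
    by unfold_locales (auto simp: ext_scale_def hom_distribs algebra_simps)
qed

definition ext_span :: "('q::field \<Rightarrow> 'l::field) \<Rightarrow> 'l set \<Rightarrow> 'l set" where
  "ext_span \<iota> = Modules.module.span (ext_scale \<iota>)"

definition ext_basis :: "('q::field \<Rightarrow> 'l::field) \<Rightarrow> 'l list \<Rightarrow> bool" where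
  "ext_basis \<iota> xs \<longleftrightarrow>
     distinct xs \<and> \<not> Modules.module.dependent (ext_scale \<iota>) (set xs) \<and> ext_span \<iota> (set xs) = UNIV"

text \<open>The \<open>'l\<close>-space \<open>'l\<^sup>n\<close> with scalars restricted to \<open>'q\<close>.\<close>

definition ext_module_vec :: "('q::field \<Rightarrow> 'l::field) \<Rightarrow> nat \<Rightarrow> ('q, 'l vec) module" where
  "ext_module_vec \<iota> n = \<lparr>
     carrier = carrier_vec n,
     mult = undefined,
     one = undefined,
     zero = 0\<^sub>v n,
     add = (+),
     smult = (\<lambda>c v. \<iota> c \<cdot>\<^sub>v v)\<rparr>"

lemma vectorspace_ext_module_vec:
  fixes \<iota> :: "'q::field \<Rightarrow> 'l::field"
  assumes "field_hom \<iota>"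
  shows "vectorspace class_ring (ext_module_vec \<iota> n)"
proof -
  interpret field_hom \<iota> by fact
  have ag: "abelian_group (ext_module_vec \<iota> n)"
  proof (rule abelian_groupI)
    fix x assume "x \<in> carrier (ext_module_vec \<iota> n)"
    then show "\<exists>y\<in>carrier (ext_module_vec \<iota> n).
        y \<oplus>\<^bsub>ext_module_vec \<iota> n\<^esub> x = \<zero>\<^bsub>ext_module_vec \<iota> n\<^esub>"
      by (intro bexI[of _ "- x"]) (auto simp: ext_module_vec_def)
  qed (auto simp: ext_module_vec_def assoc_add_vec comm_add_vec)
  interpret abelian_group "ext_module_vec \<iota> n" by (rule ag)
  show ?thesis
    by (unfold_locales)
       (auto simp: ext_module_vec_def hom_distribs add_smult_distrib_vec smult_add_distrib_vec
         smult_smult_assoc field_simps)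
qed

definition vec_rank :: "('q::field \<Rightarrow> 'l::field) \<Rightarrow> 'l vec \<Rightarrow> nat" where
  "vec_rank \<iota> a = Vector_Spaces.vector_space.dim (ext_scale \<iota>) (ext_span \<iota> (set\<^sub>v a))"

text \<open>Rank distance \<open>\<delta>\<close> of a code \<open>C\<close>, for a rank function \<open>rk\<close> and zero element \<open>z\<close>. The zero code
  has no rank distance.\<close>

definition has_rank_distance :: "('a \<Rightarrow> nat) \<Rightarrow> 'a \<Rightarrow> 'a set \<Rightarrow> nat \<Rightarrow> bool" where
  "has_rank_distance rk z C \<delta> \<longleftrightarrow> C - {z} \<noteq> {} \<and> Min (rk ` (C - {z})) = \<delta>"

definition mrd_code ::
  "('q::{field,finite} \<Rightarrow> 'l::{field,finite}) \<Rightarrow> nat \<Rightarrow> nat \<Rightarrow> nat \<Rightarrow> 'l vec set \<Rightarrow> bool" where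
  "mrd_code \<iota> m n \<delta> D \<longleftrightarrow>
     VectorSpace.subspace class_ring D (ext_module_vec \<iota> n) \<and>
     vectorspace.dim class_ring ((ext_module_vec \<iota> n)\<lparr>carrier := D\<rparr>) = m * (n - \<delta> + 1) \<and>
     has_rank_distance (vec_rank \<iota>) (0\<^sub>v n) D \<delta>"

definition linear_mrd_code ::
  "('q::{field,finite} \<Rightarrow> 'l::{field,finite}) \<Rightarrow> nat \<Rightarrow> nat \<Rightarrow> nat \<Rightarrow> 'l vec set \<Rightarrow> bool" where
  "linear_mrd_code \<iota> m n \<delta> D \<longleftrightarrow>
     mrd_code \<iota> m n \<delta> D \<and> VectorSpace.subspace class_ring D (module_vec TYPE('l) n)"

definition generator_matrix :: "nat \<Rightarrow> 'l::field mat \<Rightarrow> 'l vec set \<Rightarrow> bool" where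
  "generator_matrix n G D \<longleftrightarrow>
     distinct (rows G) \<and>
     vectorspace.basis class_ring ((module_vec TYPE('l) n)\<lparr>carrier := D\<rparr>) (set (rows G))"

text \<open>The map \<open>\<phi>\<^sub>B\<close>: column \<open>j\<close> holds the coordinates of \<open>a\<^sub>j\<close> in the ordered basis \<open>xs\<close>.\<close>

definition coord_mat ::
  "('q::field \<Rightarrow> 'l::field) \<Rightarrow> 'l list \<Rightarrow> 'l vec \<Rightarrow> 'q mat" where
  "coord_mat \<iota> xs a = mat (length xs) (dim_vec a)
     (\<lambda>(i, j). Modules.module.representation (ext_scale \<iota>) (set xs) (a $ j) (xs ! i))"

text \<open>Diagrams use indices starting from 1; vectors and matrices use indices starting from 0.
  The product \<open>u G\<close> of a row vector and a matrix is written \<open>G\<^sup>T *\<^sub>v u\<close>.\<close>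

definition ferrers_diagram :: "nat \<Rightarrow> nat \<Rightarrow> (nat \<times> nat) set \<Rightarrow> bool" where
  "ferrers_diagram m n F \<longleftrightarrow>
     F \<subseteq> {1..m} \<times> {1..n} \<and>
     (\<forall>i j. (i, j) \<in> F \<and> j < n \<longrightarrow> (i, j + 1) \<in> F) \<and>
     (\<forall>i j. (i, j) \<in> F \<and> i > 1 \<longrightarrow> (i - 1, j) \<in> F)"

definition col_size :: "(nat \<times> nat) set \<Rightarrow> nat \<Rightarrow> nat" where
  "col_size F j = card {i. (i, j) \<in> F}"

text \<open>The truncated subtraction of \<open>nat\<close> provides the maximum with 0.\<close>

definition nu :: "nat \<Rightarrow> (nat \<times> nat) set \<Rightarrow> nat \<Rightarrow> nat \<Rightarrow> nat" where
  "nu n F \<delta> j = (\<Sum>t = 1..n - \<delta> + 1 + j. col_size F t - j)"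

definition nu_min :: "nat \<Rightarrow> (nat \<times> nat) set \<Rightarrow> nat \<Rightarrow> nat" where
  "nu_min n F \<delta> = Min (nu n F \<delta> ` {0..<\<delta>})"

definition ferrers_code ::
  "nat \<Rightarrow> nat \<Rightarrow> (nat \<times> nat) set \<Rightarrow> nat \<Rightarrow> 'q::{field,finite} mat set \<Rightarrow> bool" where
  "ferrers_code m n F \<delta> C \<longleftrightarrow>
     VectorSpace.subspace class_ring C (module_mat TYPE('q) m n) \<and>
     (\<forall>M\<in>C. \<forall>i<m. \<forall>j<n. M $$ (i, j) \<noteq> 0 \<longrightarrow> (i + 1, j + 1) \<in> F) \<and>
     (has_rank_distance (vec_space.rank m) (0\<^sub>m m n) C \<delta> \<or>
      nu_min n F \<delta> = 0 \<and> C = {0\<^sub>m m n})"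

definition maximal_ferrers_code ::
  "nat \<Rightarrow> nat \<Rightarrow> (nat \<times> nat) set \<Rightarrow> nat \<Rightarrow> 'q::{field,finite} mat set \<Rightarrow> bool" where
  "maximal_ferrers_code m n F \<delta> C \<longleftrightarrow>
     ferrers_code m n F \<delta> C \<and>
     vectorspace.dim class_ring ((module_mat TYPE('q) m n)\<lparr>carrier := C\<rparr>) = nu_min n F \<delta>"

end

theory Submission
  imports Defs
begin

text \<open>Write \<open>X c\<close> for the span of the first \<open>c\<close> elements of the basis sought. The code has its support
  in the diagram iff multiplication by each entry \<open>a t j\<close> of \<open>A\<close> maps \<open>X (c t)\<close> into \<open>X (c j)\<close>, for
  \<open>t \<le> l < j\<close>. Fix the spans for the columns \<open>j > l\<close> first, and cut \<open>X (c (l + 1))\<close> down by the preimages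
  under these multiplications, one row of \<open>A\<close> at a time: each row costs at most \<open>\<epsilon>\<close> dimensions, so the
  hypothesis leaves enough room, and a basis adapted to the resulting chain works. The minimum rank
  is at least \<open>\<delta>\<close> since the code sits inside the MRD code, and it is attained by a multiple of the last
  row of \<open>G\<close>, which has at most \<open>\<delta>\<close> nonzero entries. The dimension is \<open>\<nu>\<^sub>0\<close> because \<open>G\<close> is systematic;
  that \<open>\<nu>\<^sub>0\<close> is the minimum follows from the Etzion--Silberstein bound applied to this very code.\<close>

subsection \<open>Subspaces over a finite field\<close>

lemma one_less_card_field: "1 < CARD('a::{zero_neq_one,finite})"
  using card_mono[of UNIV "{0, 1 :: 'a}"] by simp

locale finite_vector_space = Vector_Spaces.vector_space scale
  for scale :: "'a::{field,finite} \<Rightarrow> 'b::{ab_group_add,finite} \<Rightarrow> 'b"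
begin

text \<open>Taking coordinates with respect to \<open>B\<close> is a bijection from the span onto
  the functions from \<open>B\<close> to the field; forming the linear combination is its
  inverse.\<close>

lemma card_span_independent:
  assumes B: "independent B"
  shows "card (span B) = CARD('a) ^ card B"
proof -
  define h where "h f = (\<Sum>b\<in>B. scale (f b) b)" for f
  define r where "r v = restrict (representation B v) B" for v
  have fin: "finite B" by simp
  have in_span: "h f \<in> span B" for f
    unfolding h_def by (intro span_sum span_scale span_base)
  have hr: "h (r v) = v" if "v \<in> span B" for v
    using sum_representation_eq[OF B that fin] by (simp add: h_def r_def)
  have rh: "r (h f) = f" if f: "f \<in> B \<rightarrow>\<^sub>E UNIV" for f
  proof -
    \<comment> \<open>A function in the extensional product is \<open>undefined\<close> off
      \<open>B\<close>, whereas a representation vanishes there; \<open>g\<close> is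
      \<open>f\<close> with that default replaced by 0.\<close>
    define g where "g b = (if b \<in> B then f b else 0)" for b
    have "(\<Sum>b | g b \<noteq> 0. scale (g b) b) = h f"
      unfolding h_def by (rule sum.mono_neutral_cong_left) (auto simp: g_def split: if_splits)
    then have "representation B (h f) = g"
      by (intro representation_eqI[OF B in_span]) (auto simp: g_def split: if_splits)
    then show ?thesis
      using f by (auto simp: r_def g_def PiE_def extensional_def restrict_def fun_eq_iff)
  qed
  have "bij_betw r (span B) (B \<rightarrow>\<^sub>E UNIV)"
  proof (rule bij_betw_byWitness[where f' = h])
    show "\<forall>v\<in>span B. h (r v) = v" using hr by blast
    show "\<forall>f\<in>B \<rightarrow>\<^sub>E UNIV. r (h f) = f" using rh by blast
    show "r ` span B \<subseteq> B \<rightarrow>\<^sub>E UNIV" unfolding r_def by auto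
    show "h ` (B \<rightarrow>\<^sub>E UNIV) \<subseteq> span B" using in_span by blast
  qed
  then have "card (span B) = card (B \<rightarrow>\<^sub>E (UNIV :: 'a set))"
    by (rule bij_betw_same_card)
  then show ?thesis by (simp add: card_PiE)
qed

text \<open>Makes dimension claims accessible to counting: the field has more than one element, so
  cardinalities determine dimensions.\<close>

lemma card_subspace:
  assumes "subspace S"
  shows "card S = CARD('a) ^ dim S"
proof -
  obtain B where "B \<subseteq> S" "independent B" "S \<subseteq> span B" "card B = dim S"
    by (rule basis_exists)
  with assms show ?thesis
    using card_span_independent[of B] span_minimal[of B S] by (auto simp: subset_antisym)
qed

lemma dim_mono:
  assumes "S \<subseteq> span T"
  shows "dim S \<le> dim T"
proof -
  obtain B where "independent B" "T \<subseteq> span B" "card B = dim T"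
    by (rule basis_exists)
  with assms show ?thesis
    using dim_le_card[of S B] span_minimal[of T "span B"] by auto
qed

lemma subspace_vimage:
  assumes "subspace S" "Vector_Spaces.linear scale scale f"
  shows "subspace (f -` S)"
proof -
  interpret f: Vector_Spaces.linear scale scale f by fact
  show ?thesis
    using assms(1) by (auto simp: subspace_def f.add f.scale f.zero)
qed

text \<open>In additive form: the condition \<open>f v \<in> S\<close> costs at most the codimension
  of \<open>S\<close>. The proof counts \<open>V \<times> S\<close> by the fibres of a map into the
  whole space.\<close>

lemma dim_vimage_ge:
  assumes V: "subspace V" and S: "subspace S" and f: "Vector_Spaces.linear scale scale f"
  shows "dim V + dim S \<le> dim (V \<inter> f -` S) + dim (UNIV :: 'b set)"
proof -
  interpret f: Vector_Spaces.linear scale scale f by fact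
  have W: "subspace (V \<inter> f -` S)"
    by (intro subspace_inter V subspace_vimage S f)
  txt \<open>Each fibre of \<open>(v, s) \<mapsto> f v + s\<close> on \<open>V \<times> S\<close> embeds into \<open>V \<inter> f -` S\<close> by translation.\<close>
  define P where "P w = {(v, s). v \<in> V \<and> s \<in> S \<and> f v + s = w}" for w
  have P_le: "card (P w) \<le> card (V \<inter> f -` S)" for w
  proof (cases "P w = {}")
    case False
    then obtain v0 s0 where 0: "(v0, s0) \<in> P w" by auto
    have "inj_on (\<lambda>(v, s). v - v0) (P w)"
      by (auto simp: inj_on_def P_def)
    moreover have "(\<lambda>(v, s). v - v0) ` P w \<subseteq> V \<inter> f -` S"
    proof clarify
      fix v s assume vs: "(v, s) \<in> P w"
      have "f (v - v0) = s0 - s"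
        using 0 vs by (auto simp: P_def f.diff) (metis add_diff_cancel_left add_diff_cancel_right
          diff_add_eq)
      then show "v - v0 \<in> V \<inter> f -` S"
        using 0 vs V S by (auto simp: P_def subspace_diff)
    qed
    ultimately show ?thesis by (intro card_inj_on_le) auto
  qed simp
  have "card V * card S = card (\<Union>w. P w)"
    by (subst card_cartesian_product[symmetric]) (rule arg_cong[where f = card], auto simp: P_def)
  also have "\<dots> \<le> (\<Sum>w\<in>UNIV. card (P w))"
    by (rule card_UN_le) simp
  also have "\<dots> \<le> (\<Sum>w\<in>(UNIV :: 'b set). card (V \<inter> f -` S))"
    by (rule sum_mono) (rule P_le)
  finally have "card V * card S \<le> card (V \<inter> f -` S) * card (UNIV :: 'b set)"
    by (simp add: mult.commute)
  then have "CARD('a) ^ (dim V + dim S) \<le> CARD('a) ^ (dim (V \<inter> f -` S) + dim (UNIV :: 'b set))"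
    by (simp add: card_subspace[OF V] card_subspace[OF S] card_subspace[OF W]
        card_subspace[OF subspace_UNIV] power_add)
  then show ?thesis
    using one_less_card_field[where 'a = 'a] by simp
qed

text \<open>The costs of the single conditions add up, by one use of the preceding bound for each
  index.\<close>

lemma dim_INT_vimage_ge:
  assumes "finite I" and V: "subspace V"
    and S: "\<And>i. i \<in> I \<Longrightarrow> subspace (S i)" and f: "\<And>i. i \<in> I \<Longrightarrow> Vector_Spaces.linear scale scale (f i)"
  shows "dim V + (\<Sum>i\<in>I. dim (S i)) \<le>
    dim (V \<inter> (\<Inter>i\<in>I. f i -` S i)) + card I * dim (UNIV :: 'b set)"
  using assms(1) S f
proof (induction I)
  case (insert i I)
  let ?W = "V \<inter> (\<Inter>i\<in>I. f i -` S i)"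
  have "subspace (f j -` S j)" if "j \<in> I" for j
    using that insert.prems by (intro subspace_vimage) simp_all
  then have W: "subspace ?W"
    by (intro subspace_inter V subspace_Int)
  have "dim V + (\<Sum>i\<in>I. dim (S i)) \<le> dim ?W + card I * dim (UNIV :: 'b set)"
    using insert.prems by (intro insert.IH) simp_all
  moreover have "dim ?W + dim (S i) \<le> dim (?W \<inter> f i -` S i) + dim (UNIV :: 'b set)"
    using insert.prems by (intro dim_vimage_ge W) simp_all
  moreover have "?W \<inter> f i -` S i = V \<inter> (\<Inter>i\<in>insert i I. f i -` S i)"
    by (simp add: Int_ac)
  ultimately show ?case
    using insert.hyps by (simp del: INT_insert)
qed simp

text \<open>New vectors go to the end of the list, so every prefix of \<open>xs\<close> survives.
  With \<open>xs\<close> empty it yields an ordered basis of \<open>V\<close>.\<close>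

lemma independent_extend_list:
  assumes xs: "distinct xs" "independent (set xs)" and V: "subspace V" "set xs \<subseteq> V"
  obtains ys where "distinct (xs @ ys)" "independent (set (xs @ ys))" "span (set (xs @ ys)) = V"
proof -
  obtain B where B: "set xs \<subseteq> B" "B \<subseteq> V" "independent B" "V \<subseteq> span B"
    using maximal_independent_subset_extend[OF V(2) xs(2)] .
  obtain ys where ys: "set ys = B - set xs" "distinct ys"
    using finite_distinct_list[of "B - set xs"] by auto
  have "set (xs @ ys) = B" using B(1) ys by auto
  moreover have "span B = V" using B V(1) by (simp add: span_minimal subset_antisym)
  ultimately show thesis
    using that[of ys] B(3) ys xs(1) by auto
qed

text \<open>Climb the chain and append to a basis of \<open>S N\<close> whatever
  \<open>S (Suc N)\<close> requires; each smaller member then stays the span of a prefix.\<close>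

lemma adapted_basis:
  assumes S: "\<And>k. subspace (S k)" and chain: "\<And>k. S k \<subseteq> S (Suc k)"
  shows "\<exists>xs. distinct xs \<and> independent (set xs) \<and> span (set xs) = S N \<and>
    (\<forall>k\<le>N. span (set (take (dim (S k)) xs)) = S k)"
proof (induction N)
  case 0
  obtain xs where "distinct ([] @ xs)" "independent (set ([] @ xs))" "span (set ([] @ xs)) = S 0"
    by (rule independent_extend_list[of "[]" "S 0"]) (auto simp: S independent_empty)
  then have "distinct xs" "independent (set xs)" "span (set xs) = S 0"
    by simp_all
  moreover from this have "length xs = dim (S 0)"
    using dim_span_eq_card_independent[of "set xs"] by (simp add: distinct_card)
  ultimately show ?case by (intro exI[of _ xs]) auto
next
  case (Suc N)
  then obtain xs where xs: "distinct xs" "independent (set xs)" "span (set xs) = S N"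
    and flag: "\<And>k. k \<le> N \<Longrightarrow> span (set (take (dim (S k)) xs)) = S k" by auto
  have "set xs \<subseteq> S (Suc N)"
    using span_superset[of "set xs"] chain[of N] unfolding xs(3) by (rule subset_trans)
  then obtain ys where ys: "distinct (xs @ ys)" "independent (set (xs @ ys))"
      "span (set (xs @ ys)) = S (Suc N)"
    using independent_extend_list[OF xs(1,2) S] by metis
  have len: "length xs = dim (S N)"
    using dim_span_eq_card_independent[OF xs(2)] distinct_card[OF xs(1)] by (simp only: xs(3))
  have len': "length (xs @ ys) = dim (S (Suc N))"
    using dim_span_eq_card_independent[OF ys(2)] distinct_card[OF ys(1)] by (simp only: ys(3))
  have "span (set (take (dim (S k)) (xs @ ys))) = S k" if "k \<le> Suc N" for k
  proof (cases "k = Suc N")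
    case True
    then show ?thesis using len' ys(3) by simp
  next
    case False
    with that have "k \<le> N" by simp
    then have "S k \<subseteq> S N" using chain by (rule lift_Suc_mono_le[rotated])
    \<comment> \<open>The prefix belonging to \<open>S k\<close> ends inside \<open>xs\<close>, so
      appending \<open>ys\<close> leaves it unchanged.\<close>
    then have "dim (S k) \<le> length xs"
      unfolding len using span_superset[of "S N"] by (intro dim_mono) auto
    then show ?thesis using flag[OF \<open>k \<le> N\<close>] by simp
  qed
  with ys show ?case by blast
qed

end

subsection \<open>Bases compatible with multiplications\<close>

locale finite_field_ext = field_hom \<iota> for \<iota> :: "'q::{field,finite} \<Rightarrow> 'l::{field,finite}"
begin

sublocale E: finite_vector_space "ext_scale \<iota>"
  by (intro finite_vector_space.intro vector_space_ext_scale field_hom_axioms)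

lemma linear_times: "Vector_Spaces.linear (ext_scale \<iota>) (ext_scale \<iota>) (\<lambda>u. a * u)"
  by unfold_locales (simp_all add: ext_scale_def algebra_simps)

lemma dim_UNIV_eq:
  assumes "CARD('l) = CARD('q) ^ m"
  shows "E.dim (UNIV :: 'l set) = m"
  using E.card_subspace[OF E.subspace_UNIV] assms one_less_card_field[where 'a = 'q] by simp

lemma dim_span_take:
  assumes "distinct xs" "E.independent (set xs)" "k \<le> length xs"
  shows "E.dim (E.span (set (take k xs))) = k"
proof -
  have "E.independent (set (take k xs))"
    using assms(2) by (rule E.independent_mono) (rule set_take_subset)
  then show ?thesis
    using assms(1,3) by (simp add: E.dim_eq_card_independent distinct_card)
qed

text \<open>The assumption \<open>gap\<close> is the hypothesis on the column sizes with its
  subtraction moved to the other side. The factors \<open>a t j\<close> may be arbitrary, as any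
  multiplication is linear over the small field.\<close>

lemma adapted_flag:
  fixes c :: "nat \<Rightarrow> nat" and a :: "nat \<Rightarrow> nat \<Rightarrow> 'l"
  assumes card: "CARD('l) = CARD('q) ^ m" and "l < n"
    and mono: "\<And>i j. l < i \<Longrightarrow> i \<le> j \<Longrightarrow> j \<le> n \<Longrightarrow> c i \<le> c j"
    and le: "\<And>j. l < j \<Longrightarrow> j \<le> n \<Longrightarrow> c j \<le> m"
    and gap: "\<And>t. t \<in> {1..l} \<Longrightarrow> c t + (l + 1 - t) * (\<Sum>j = l + 1..n. m - c j) \<le> c (l + 1)"
  obtains xs where "length xs = m" "ext_basis \<iota> xs"
    "\<And>t j u. t \<in> {1..l} \<Longrightarrow> j \<in> {l + 1..n} \<Longrightarrow> u \<in> ext_span \<iota> (set (take (c t) xs)) \<Longrightarrow>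
       a t j * u \<in> ext_span \<iota> (set (take (c j) xs))"
proof -
  obtain ys :: "'l list" where "distinct ([] @ ys)" "E.independent (set ([] @ ys))"
      "E.span (set ([] @ ys)) = UNIV"
    by (rule E.independent_extend_list[of "[]" UNIV]) (auto simp: E.independent_empty)
  then have ys: "distinct ys" "E.independent (set ys)" "E.span (set ys) = UNIV"
    by simp_all
  have len_ys: "length ys = m"
    using E.dim_span_eq_card_independent[OF ys(2)] ys dim_UNIV_eq[OF card]
    by (simp add: distinct_card)
  define T where "T j = E.span (set (take (c j) ys))" for j
  txt \<open>A chain with \<open>a t j * S t \<subseteq> T j = S j\<close> for \<open>t \<le> l < j\<close>. Each step down from \<open>T (l + 1)\<close> imposes one
    more condition per column \<open>j\<close>, so it loses at most \<open>\<Sum>j. m - c j\<close> dimensions.\<close>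
  define S where "S k = (if k \<le> l
      then T (l + 1) \<inter> (\<Inter>p\<in>{k..l} \<times> {l + 1..n}. (\<lambda>u. a (fst p) (snd p) * u) -` T (snd p))
      else if k \<le> n then T k else UNIV)" for k
  have T: "E.subspace (T j)" for j
    by (simp add: T_def)
  have dim_T: "E.dim (T j) = c j" if "j \<in> {l + 1..n}" for j
    using that le unfolding T_def by (intro dim_span_take ys) (simp add: len_ys)
  have S: "E.subspace (S k)" for k
    by (auto simp: S_def intro!: E.subspace_inter E.subspace_Int E.subspace_vimage T linear_times)
  have T_mono: "T i \<subseteq> T j" if "l < i" "i \<le> j" "j \<le> n" for i j
    unfolding T_def using that by (intro E.span_mono set_take_subset_set_take mono)
  \<comment> \<open>For \<open>k < l\<close> the conditions for row \<open>k\<close> disappear on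
    passing to \<open>Suc k\<close>; at \<open>k = l\<close> the last ones do, leaving
    \<open>T (l + 1)\<close>; from there on the chain grows with the column sizes and ends in the
    whole field.\<close>
  have chain: "S k \<subseteq> S (Suc k)" for k
  proof (cases "k < l")
    case True
    then show ?thesis by (auto simp: S_def)
  next
    case False
    then show ?thesis
      using \<open>l < n\<close> T_mono[of k "Suc k"] by (auto simp: S_def)
  qed
  have dim_S_ge: "c t \<le> E.dim (S t)" if t: "t \<in> {1..l}" for t
  proof -
    let ?I = "{t..l} \<times> {l + 1..n}"
    let ?r = "l + 1 - t"
    have "E.dim (T (l + 1)) + (\<Sum>p\<in>?I. E.dim (T (snd p))) \<le> E.dim (S t) + card ?I * m"
      using E.dim_INT_vimage_ge[of ?I "T (l + 1)" "\<lambda>p. T (snd p)" "\<lambda>p u. a (fst p) (snd p) * u"]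
        t by (simp add: S_def T linear_times dim_UNIV_eq[OF card])
    moreover have "(\<Sum>p\<in>?I. E.dim (T (snd p))) = (\<Sum>s = t..l. \<Sum>j = l + 1..n. E.dim (T j))"
      unfolding sum.cartesian_product by (simp add: case_prod_beta')
    then have "(\<Sum>p\<in>?I. E.dim (T (snd p))) = ?r * (\<Sum>j = l + 1..n. c j)"
      by (simp add: dim_T)
    \<comment> \<open>Splitting each \<open>m\<close> into \<open>c j\<close> and
      \<open>m - c j\<close> cancels the dimensions of the \<open>T j\<close>. What is left is the
      loss that \<open>gap\<close> allows for.\<close>
    moreover have "card ?I * m = ?r * ((\<Sum>j = l + 1..n. c j) + (\<Sum>j = l + 1..n. m - c j))"
      using le by (simp add: card_cartesian_product flip: sum.distrib)
    moreover have "E.dim (T (l + 1)) = c (l + 1)"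
      using \<open>l < n\<close> by (intro dim_T) simp
    ultimately show ?thesis
      using gap[OF t] by (simp add: distrib_left)
  qed
  obtain xs where xs: "distinct xs" "E.independent (set xs)" "E.span (set xs) = S (n + 1)"
    and flag: "\<And>k. k \<le> n + 1 \<Longrightarrow> E.span (set (take (E.dim (S k)) xs)) = S k"
    using E.adapted_basis[of S "n + 1"] S chain by auto
  \<comment> \<open>The index \<open>n + 1\<close> falls into the last case of \<open>S\<close>, so
    the list is a basis of the whole field.\<close>
  have span_xs: "E.span (set xs) = UNIV"
    using xs(3) \<open>l < n\<close> by (simp add: S_def)
  have "length xs = m"
    using E.dim_span_eq_card_independent[OF xs(2)] xs(1) span_xs dim_UNIV_eq[OF card]
    by (simp add: distinct_card)
  moreover have "ext_basis \<iota> xs"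
    using xs(1,2) span_xs by (simp add: ext_basis_def ext_span_def)
  moreover have "a t j * u \<in> ext_span \<iota> (set (take (c j) xs))"
    if t: "t \<in> {1..l}" and j: "j \<in> {l + 1..n}" and u: "u \<in> ext_span \<iota> (set (take (c t) xs))" for t j u
  proof -
    \<comment> \<open>The space \<open>S t\<close> may be larger than required: the first
      \<open>c t\<close> basis elements are among the first \<open>dim (S t)\<close>, which span
      it.\<close>
    have "u \<in> E.span (set (take (E.dim (S t)) xs))"
      using u E.span_mono[OF set_take_subset_set_take[OF dim_S_ge[OF t]]]
      unfolding ext_span_def by blast
    then have "u \<in> S t"
      using flag[of t] t \<open>l < n\<close> by simp
    then have "a t j * u \<in> T j"
      using t j by (auto simp: S_def)
    moreover have "E.span (set (take (c j) xs)) = T j"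
      using flag[of j] j by (simp add: S_def dim_T)
    ultimately show ?thesis
      by (simp add: ext_span_def)
  qed
  ultimately show thesis
    by (rule that)
qed

end

subsection \<open>Coordinates and rank\<close>

text \<open>The counterpart of \<open>card_subspace\<close> for spaces with an explicit carrier:
  linear combinations of a basis are unique. It carries ranks and code dimensions over to
  cardinalities.\<close>

lemma (in vectorspace) card_carrier_eq_power_dim:
  assumes "finite (carrier V)"
  shows "card (carrier V) = card (carrier K) ^ dim"
proof -
  \<comment> \<open>A finite space is generated by all its elements, so it has a finite
    basis.\<close>
  have "gen_set (carrier V)"
    using in_own_span[of "carrier V"] span_is_subset2[of "carrier V"] by auto
  with assms have "fin_dim"
    unfolding fin_dim_def by blast
  then obtain B where B: "finite B" "basis B"
    using finite_basis_exists by blast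
  then have BV: "B \<subseteq> carrier V"
    by (simp add: basis_def)
  have unique: "\<exists>!f. f \<in> B \<rightarrow>\<^sub>E carrier K \<and> lincomb f B = v" if "v \<in> carrier V" for v
    using basis_criterion[OF B(1) BV] B(2) that by blast
  have closed: "lincomb f B \<in> carrier V" if "f \<in> B \<rightarrow>\<^sub>E carrier K" for f
    using that BV by (intro lincomb_closed) auto
  have "bij_betw (\<lambda>f. lincomb f B) (B \<rightarrow>\<^sub>E carrier K) (carrier V)"
  proof (rule bij_betw_imageI)
    show "inj_on (\<lambda>f. lincomb f B) (B \<rightarrow>\<^sub>E carrier K)"
    proof (rule inj_onI)
      fix f g assume fg: "f \<in> B \<rightarrow>\<^sub>E carrier K" "g \<in> B \<rightarrow>\<^sub>E carrier K" "lincomb f B = lincomb g B"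
      from unique[OF closed[OF fg(2)]] show "f = g"
        by (elim ex1E) (metis fg)
    qed
    show "(\<lambda>f. lincomb f B) ` (B \<rightarrow>\<^sub>E carrier K) = carrier V"
    proof (intro subset_antisym subsetI)
      fix v assume "v \<in> carrier V"
      from ex1_implies_ex[OF unique[OF this]] obtain f
        where "f \<in> B \<rightarrow>\<^sub>E carrier K" "v = lincomb f B" by auto
      then show "v \<in> (\<lambda>f. lincomb f B) ` (B \<rightarrow>\<^sub>E carrier K)" by blast
    qed (auto intro: closed)
  qed
  then have "card (B \<rightarrow>\<^sub>E carrier K) = card (carrier V)"
    by (rule bij_betw_same_card)
  then show ?thesis
    using dim_basis[OF B] B(1) by (simp add: card_PiE)
qed

locale finite_field_ext_basis = finite_field_ext \<iota>
  for \<iota> :: "'q::{field,finite} \<Rightarrow> 'l::{field,finite}" +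
  fixes xs :: "'l list" and m :: nat
  assumes basis: "ext_basis \<iota> xs" and length_xs [simp]: "length xs = m"
begin

lemma distinct_xs: "distinct xs"
  and independent_xs: "E.independent (set xs)"
  and span_xs [simp]: "E.span (set xs) = UNIV"
  using basis by (simp_all add: ext_basis_def ext_span_def)

definition coord :: "'l \<Rightarrow> nat \<Rightarrow> 'q" where
  "coord a i = E.representation (set xs) a (xs ! i)"

lemma coord_zero [simp]: "coord 0 i = 0"
  by (simp add: coord_def E.representation_zero)

lemma coord_add: "coord (a + b) i = coord a i + coord b i"
  by (simp add: coord_def E.representation_add independent_xs)

lemma coord_scale: "coord (\<iota> c * a) i = c * coord a i"
  using E.representation_scale[OF independent_xs, of a c]
  by (simp add: coord_def ext_scale_def)

lemma sum_coord: "(\<Sum>i<m. \<iota> (coord a i) * xs ! i) = a"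
proof -
  have "(\<Sum>i<m. \<iota> (coord a i) * xs ! i) =
      (\<Sum>b\<in>set xs. ext_scale \<iota> (E.representation (set xs) a b) b)"
    using sum.reindex_bij_betw[OF bij_betw_nth[OF distinct_xs refl refl],
        of "\<lambda>b. ext_scale \<iota> (E.representation (set xs) a b) b"]
    by (simp add: coord_def ext_scale_def)
  also have "\<dots> = a"
    by (intro E.sum_representation_eq independent_xs) simp_all
  finally show ?thesis .
qed

lemma coord_eqI:
  assumes "\<And>i. i < m \<Longrightarrow> coord a i = coord b i"
  shows "a = b"
proof -
  have "a = (\<Sum>i<m. \<iota> (coord a i) * xs ! i)"
    by (rule sum_coord[symmetric])
  also have "\<dots> = (\<Sum>i<m. \<iota> (coord b i) * xs ! i)"
    using assms by (intro sum.cong refl) simp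
  also have "\<dots> = b"
    by (rule sum_coord)
  finally show ?thesis .
qed

text \<open>Translates between the flag of prefix spans and the shape of matrices: a column is
  confined to its top \<open>k\<close> rows iff the entry it represents lies in the span of the
  first \<open>k\<close> basis elements.\<close>

lemma span_take_iff:
  "a \<in> ext_span \<iota> (set (take k xs)) \<longleftrightarrow> (\<forall>i<m. k \<le> i \<longrightarrow> coord a i = 0)"
proof
  assume a: "a \<in> ext_span \<iota> (set (take k xs))"
  have "E.representation (set xs) a = E.representation (set (take k xs)) a"
    using a by (intro E.representation_extend independent_xs set_take_subset)
      (simp add: ext_span_def)
  moreover have "xs ! i \<notin> set (take k xs)" if "i < m" "k \<le> i" for i
    using that distinct_xs by (auto simp: in_set_conv_nth nth_eq_iff_index_eq)
  ultimately show "\<forall>i<m. k \<le> i \<longrightarrow> coord a i = 0"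
    using E.representation_ne_zero[of "set (take k xs)" a] by (auto simp: coord_def)
next
  assume *: "\<forall>i<m. k \<le> i \<longrightarrow> coord a i = 0"
  have "ext_scale \<iota> (coord a i) (xs ! i) \<in> E.span (set (take k xs))" if "i < m" for i
  proof (cases "i < k")
    case True
    with that have "xs ! i \<in> set (take k xs)"
      by (auto simp: in_set_conv_nth intro!: exI[of _ i])
    then show ?thesis by (intro E.span_scale E.span_base)
  qed (use * that E.span_zero in simp)
  then have "(\<Sum>i<m. ext_scale \<iota> (coord a i) (xs ! i)) \<in> E.span (set (take k xs))"
    by (intro E.span_sum) simp
  then show "a \<in> ext_span \<iota> (set (take k xs))"
    using sum_coord[of a] by (simp add: ext_span_def ext_scale_def)
qed

lemma coord_mat_index [simp]:
  "i < m \<Longrightarrow> j < dim_vec a \<Longrightarrow> coord_mat \<iota> xs a $$ (i, j) = coord (a $ j) i"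
  by (simp add: coord_mat_def coord_def)

lemma coord_mat_dim [simp]:
  "dim_row (coord_mat \<iota> xs a) = m" "dim_col (coord_mat \<iota> xs a) = dim_vec a"
  by (simp_all add: coord_mat_def)

lemma coord_mat_zero: "coord_mat \<iota> xs (0\<^sub>v n) = 0\<^sub>m m n"
  by (rule eq_matI) auto

lemma coord_mat_add:
  "dim_vec a = dim_vec b \<Longrightarrow> coord_mat \<iota> xs (a + b) = coord_mat \<iota> xs a + coord_mat \<iota> xs b"
  by (rule eq_matI) (auto simp: coord_add)

lemma coord_mat_smult: "coord_mat \<iota> xs (\<iota> c \<cdot>\<^sub>v a) = c \<cdot>\<^sub>m coord_mat \<iota> xs a"
  by (rule eq_matI) (auto simp: coord_scale)

lemma coord_mat_inject:
  assumes "dim_vec a = dim_vec b" "coord_mat \<iota> xs a = coord_mat \<iota> xs b"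
  shows "a = b"
proof (rule eq_vecI)
  fix j assume "j < dim_vec b"
  then show "a $ j = b $ j"
    using assms by (intro coord_eqI) (metis coord_mat_index)
qed (fact assms)

lemma card_ext_span: "card (ext_span \<iota> X) = CARD('q) ^ E.dim (ext_span \<iota> X)"
  unfolding ext_span_def by (rule E.card_subspace) simp

lemma card_span_take:
  assumes "k \<le> m"
  shows "card (ext_span \<iota> (set (take k xs))) = CARD('q) ^ k"
  using assms dim_span_take[OF distinct_xs independent_xs]
  by (simp add: card_ext_span) (simp add: ext_span_def)

text \<open>The coordinate map \<open>\<kappa>\<close> is linear and injective and sends the entries
  of \<open>a\<close> to the columns of the matrix. Hence it maps the span of the entries
  bijectively onto the column space, and equal cardinalities give equal dimensions.\<close>

lemma rank_coord_mat: "vec_space.rank m (coord_mat \<iota> xs a) = vec_rank \<iota> a"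
proof -
  interpret V: vec_space "TYPE('q)" m .
  define \<kappa> where "\<kappa> b = vec m (coord b)" for b
  have inj: "inj \<kappa>"
  proof (rule injI, rule coord_eqI)
    fix b b' i assume "\<kappa> b = \<kappa> b'" "i < m"
    then have "vec m (coord b) $ i = vec m (coord b') $ i"
      by (simp only: \<kappa>_def)
    then show "coord b i = coord b' i"
      using \<open>i < m\<close> by simp
  qed
  have \<kappa>: "\<kappa> 0 = 0\<^sub>v m" "\<kappa> (b + b') = \<kappa> b + \<kappa> b'" "\<kappa> (ext_scale \<iota> c b) = c \<cdot>\<^sub>v \<kappa> b" for b b' c
    by (rule eq_vecI; simp add: \<kappa>_def coord_add ext_scale_def coord_scale)+
  let ?X = "set (cols (coord_mat \<iota> xs a))"
  let ?Y = "ext_span \<iota> (set\<^sub>v a)"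
  have X: "?X = \<kappa> ` set\<^sub>v a"
  proof -
    have "col (coord_mat \<iota> xs a) j = \<kappa> (a $ j)" if "j < dim_vec a" for j
      using that by (intro eq_vecI) (simp_all add: \<kappa>_def)
    then show ?thesis
      by (simp add: cols_def vec_set_def image_image atLeast0LessThan)
  qed
  have carrier: "\<kappa> b \<in> carrier_vec m" for b
    by (simp add: \<kappa>_def)
  have XC: "?X \<subseteq> carrier_vec m"
    unfolding X using carrier by blast
  have sub: "E.subspace ?Y"
    by (simp add: ext_span_def)
  \<comment> \<open>The image of the span is a subspace containing all columns, which gives one
    inclusion; the other is by induction over linear combinations.\<close>
  have "submodule class_ring (\<kappa> ` ?Y) V.V"
  proof (rule submodule.intro)
    show "Module.module class_ring V.V" by (rule V.module_axioms)
    show "\<kappa> ` ?Y \<subseteq> carrier V.V"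
      using carrier by (auto simp: module_vec_simps)
    show "\<zero>\<^bsub>V.V\<^esub> \<in> \<kappa> ` ?Y"
      using E.subspace_0[OF sub] \<kappa>(1) by (auto simp: module_vec_simps intro: rev_image_eqI)
    show "v \<oplus>\<^bsub>V.V\<^esub> w \<in> \<kappa> ` ?Y" if "v \<in> \<kappa> ` ?Y" "w \<in> \<kappa> ` ?Y" for v w
      using that E.subspace_add[OF sub] by (auto simp: module_vec_simps \<kappa>(2)[symmetric])
    show "c \<odot>\<^bsub>V.V\<^esub> v \<in> \<kappa> ` ?Y" if "v \<in> \<kappa> ` ?Y" for c v
      using that E.subspace_scale[OF sub] by (auto simp: module_vec_simps \<kappa>(3)[symmetric])
  qed
  moreover have "?X \<subseteq> \<kappa> ` ?Y"
    unfolding X ext_span_def using E.span_superset by blast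
  ultimately have "V.span ?X \<subseteq> \<kappa> ` ?Y"
    by (intro V.span_is_subset)
  moreover have "\<kappa> b \<in> V.span ?X" if "b \<in> ?Y" for b
  proof -
    interpret S: submodule class_ring "V.span ?X" V.V
      by (rule V.span_is_submodule) (rule XC)
    have closed: "0\<^sub>v m \<in> V.span ?X"
        "v \<in> V.span ?X \<Longrightarrow> w \<in> V.span ?X \<Longrightarrow> v + w \<in> V.span ?X"
        "v \<in> V.span ?X \<Longrightarrow> c \<cdot>\<^sub>v v \<in> V.span ?X" for v w c
      using S.zero_closed S.m_closed[of v w] S.smult_closed[of c v]
      by (simp_all add: module_vec_simps)
    show ?thesis
      using that unfolding ext_span_def
    proof (induction rule: E.span_induct_alt)
      case base
      then show ?case using closed(1) by (simp add: \<kappa>(1))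
    next
      case (step c y z)
      have "\<kappa> y \<in> ?X"
        using step(1) unfolding X by (rule imageI)
      then have "\<kappa> y \<in> V.span ?X"
        using V.in_own_span[OF XC] by (rule rev_subsetD)
      then show ?case
        unfolding \<kappa>(2,3) by (intro closed step(2))
    qed
  qed
  ultimately have "V.span ?X = \<kappa> ` ?Y"
    by blast
  then have card: "card (V.span ?X) = card ?Y" and fin: "finite (V.span ?X)"
    using inj by (simp_all add: card_image inj_on_subset)
  have "vectorspace class_ring (V.span_vs ?X)"
    using XC by (intro V.subspace_is_vs V.span_is_subspace) simp
  then interpret W: vectorspace class_ring "V.span_vs ?X" .
  have "card (V.span ?X) = CARD('q) ^ V.rank (coord_mat \<iota> xs a)"
    using W.card_carrier_eq_power_dim fin by (simp add: V.rank_def)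
  moreover have "card ?Y = CARD('q) ^ vec_rank \<iota> a"
    by (simp add: card_ext_span vec_rank_def)
  ultimately show ?thesis
    using card one_less_card_field[where 'a = 'q] by simp
qed

end

subsection \<open>Ferrers diagrams and codes\<close>

text \<open>Descending from \<open>Max C\<close> never leaves \<open>C\<close>. This is why a
  diagram is determined by its column sizes.\<close>

lemma down_closed_eq_atLeastAtMost:
  fixes C :: "nat set"
  assumes C: "C \<subseteq> {1..m}" and down: "\<And>i. i \<in> C \<Longrightarrow> i > 1 \<Longrightarrow> i - 1 \<in> C"
  shows "C = {1..card C}"
proof (cases "C = {}")
  case False
  have fin: "finite C"
    using C by (rule finite_subset) simp
  have "i \<in> C" if "i \<le> Max C" "1 \<le> i" for i
    using that
  proof (induction rule: inc_induct)
    case base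
    show ?case using fin False by (rule Max_in)
  next
    case (step i)
    then show ?case using down[of "Suc i"] by simp
  qed
  then have "C = {1..Max C}"
    using C fin by (auto intro: Max_ge)
  then show ?thesis
    by (metis card_atLeastAtMost diff_Suc_1)
qed simp

context
  fixes m n F
  assumes F: "ferrers_diagram m n F"
begin

lemma col_eq: "{i. (i, j) \<in> F} = {1..col_size F j}"
  unfolding col_size_def
  by (rule down_closed_eq_atLeastAtMost[of _ m]) (use F in \<open>auto simp: ferrers_diagram_def\<close>)

lemma ferrers_mem_iff: "(i, j) \<in> F \<longleftrightarrow> 1 \<le> i \<and> i \<le> col_size F j"
  using col_eq[of j] by auto

lemma col_size_le: "col_size F j \<le> m"
proof -
  have "{i. (i, j) \<in> F} \<subseteq> {1..m}"
    using F by (auto simp: ferrers_diagram_def)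
  from card_mono[OF _ this] show ?thesis
    by (simp add: col_size_def)
qed

lemma col_size_mono:
  assumes "i \<le> j" "j \<le> n"
  shows "col_size F i \<le> col_size F j"
  using assms
proof (induction rule: dec_induct)
  case (step k)
  have "{1..col_size F k} \<subseteq> {1..col_size F (Suc k)}"
    using F step.hyps step.prems unfolding col_eq[symmetric] by (auto simp: ferrers_diagram_def)
  \<comment> \<open>Inclusion of intervals compares their upper ends only if the smaller one is
    nonempty.\<close>
  with step show ?case
    by (cases "col_size F k = 0") auto
qed simp

end

context finite_field_ext
begin

lemma vec_rank_le:
  assumes "finite B" "\<And>j. j < dim_vec a \<Longrightarrow> a $ j \<in> E.span B"
  shows "vec_rank \<iota> a \<le> card B"
proof -
  have "set\<^sub>v a \<subseteq> E.span B"
    using assms(2) by (auto simp: vec_set_def)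
  then have "ext_span \<iota> (set\<^sub>v a) \<subseteq> E.span B"
    unfolding ext_span_def by (rule E.span_minimal) simp
  then show ?thesis
    unfolding vec_rank_def using assms(1) by (rule E.dim_le_card)
qed

end

context finite_field_ext_basis
begin

text \<open>The bound of Etzion and Silberstein: if the coordinates of \<open>a\<close> vanish in
  all but the first \<open>j\<close> rows of the first \<open>n - \<delta> + 1 + j\<close> columns, its entries are spanned by \<open>j\<close> basis elements and the last \<open>\<delta> - 1 - j\<close> entries, so its rank is
  below \<open>\<delta>\<close>.\<close>

lemma card_code_le:
  assumes E: "E \<subseteq> carrier_vec n" and diff: "\<And>a b. a \<in> E \<Longrightarrow> b \<in> E \<Longrightarrow> a - b \<in> E"
    and supp: "\<And>a t. a \<in> E \<Longrightarrow> t < n \<Longrightarrow> a $ t \<in> ext_span \<iota> (set (take (c (t + 1)) xs))"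
    and rank: "\<And>a. a \<in> E \<Longrightarrow> a \<noteq> 0\<^sub>v n \<Longrightarrow> \<delta> \<le> vec_rank \<iota> a"
    and c: "\<And>t. c t \<le> m" and j: "j < \<delta>" "\<delta> \<le> n"
  shows "card E \<le> CARD('q) ^ (\<Sum>t = 1..n - \<delta> + 1 + j. c t - j)"
proof -
  define k where "k = n - \<delta> + 1 + j"
  \<comment> \<open>\<open>P\<close> holds the cells left after deleting the top \<open>j\<close>
    rows and the last \<open>n - k\<close> columns; their number is the exponent claimed. Reading a
    word off on \<open>P\<close> is injective on \<open>E\<close>, because a difference that
    vanishes on \<open>P\<close> has rank below \<open>\<delta>\<close>.\<close>
  define P where "P = Sigma {..<k} (\<lambda>t. {j..<c (t + 1)})"
  define r where "r a = restrict (\<lambda>(t, i). coord (a $ t) i) P" for a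
  have k: "k \<le> n" "n - k + j < \<delta>"
    using j by (auto simp: k_def)
  have "inj_on r E"
  proof (rule inj_onI)
    fix a b assume a: "a \<in> E" and b: "b \<in> E" and "r a = r b"
    have dims: "a \<in> carrier_vec n" "b \<in> carrier_vec n"
      using a b E by auto
    have eq: "coord (a $ t) i = coord (b $ t) i" if "t < k" "j \<le> i" "i < c (t + 1)" for t i
      using fun_cong[OF \<open>r a = r b\<close>, of "(t, i)"] that by (simp add: r_def P_def)
    define d where "d = a - b"
    have d: "d \<in> E" "d \<in> carrier_vec n"
      using diff[OF a b] dims by (simp_all add: d_def)
    define B where "B = set (take j xs) \<union> ($) d ` {k..<n}"
    have "d $ t \<in> E.span B" if "t < n" for t
    proof (cases "t < k")
      case True
      \<comment> \<open>Above height \<open>c (t + 1)\<close> the support condition applies to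
        \<open>d\<close> itself, since \<open>E\<close> is closed under differences; up to that
        height \<open>a\<close> and \<open>b\<close> agree.\<close>
      have "coord (d $ t) i = 0" if "i < m" "j \<le> i" for i
      proof (cases "i < c (t + 1)")
        case True
        then have "coord (d $ t + b $ t) i = coord (b $ t) i"
          using eq[OF \<open>t < k\<close> that(2)] \<open>t < n\<close> dims by (simp add: d_def)
        then show ?thesis by (simp add: coord_add)
      next
        case False
        then show ?thesis
          using supp[OF d(1) \<open>t < n\<close>] that(1) by (simp add: span_take_iff)
      qed
      then have "d $ t \<in> E.span (set (take j xs))"
        unfolding ext_span_def[symmetric] by (simp add: span_take_iff)
      then show ?thesis
        unfolding B_def by (rule rev_subsetD) (intro E.span_mono Un_upper1)
    next
      case False
      then show ?thesis
        using that by (intro E.span_base) (simp add: B_def)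
    qed
    then have "vec_rank \<iota> d \<le> card B"
      using d(2) by (intro vec_rank_le) (simp_all add: B_def)
    also have "\<dots> \<le> card (set (take j xs)) + card (($) d ` {k..<n})"
      unfolding B_def by (rule card_Un_le)
    also have "\<dots> \<le> j + (n - k)"
      using card_length[of "take j xs"] card_image_le[of "{k..<n}" "($) d"]
      by (intro add_mono) simp_all
    finally have d0: "d = 0\<^sub>v n"
      using rank[OF d(1)] k(2) by (cases "d = 0\<^sub>v n") simp_all
    have "a $ t - b $ t = 0" if "t < n" for t
    proof -
      have "d $ t = 0\<^sub>v n $ t"
        by (simp only: d0)
      then show ?thesis
        using that dims by (simp add: d_def)
    qed
    then show "a = b"
      using dims by (intro eq_vecI) auto
  qed
  moreover have "r ` E \<subseteq> P \<rightarrow>\<^sub>E UNIV"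
    by (auto simp: r_def)
  moreover have "finite P"
    by (simp add: P_def)
  ultimately have "card E \<le> card (P \<rightarrow>\<^sub>E (UNIV :: 'q set))"
    by (intro card_inj_on_le finite_PiE) simp_all
  also have "\<dots> = CARD('q) ^ card P"
    using \<open>finite P\<close> by (simp add: card_PiE)
  also have "card P = (\<Sum>t<k. c (Suc t) - j)"
    by (simp add: P_def)
  also have "\<dots> = (\<Sum>t = 1..k. c t - j)"
    by (rule sum.reindex_bij_witness[of _ "\<lambda>t. t - 1" Suc]) auto
  finally show ?thesis
    by (simp add: k_def)
qed

lemma subspace_coord_mat_image:
  assumes E: "E \<subseteq> carrier_vec n" and zero: "0\<^sub>v n \<in> E"
    and add: "\<And>a b. a \<in> E \<Longrightarrow> b \<in> E \<Longrightarrow> a + b \<in> E"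
    and scale: "\<And>a k. a \<in> E \<Longrightarrow> \<iota> k \<cdot>\<^sub>v a \<in> E"
  shows "VectorSpace.subspace class_ring (coord_mat \<iota> xs ` E) (module_mat TYPE('q) m n)"
proof -
  interpret M: matrix_vs m n "TYPE('q)" .
  have dim: "dim_vec a = n" if "a \<in> E" for a
    using that E by auto
  have "submodule class_ring (coord_mat \<iota> xs ` E) M.V"
  proof (rule submodule.intro)
    show "Module.module class_ring M.V" by (rule M.module_axioms)
    show "coord_mat \<iota> xs ` E \<subseteq> carrier M.V"
      using dim by (auto simp: module_mat_simps intro!: carrier_matI)
    show "\<zero>\<^bsub>M.V\<^esub> \<in> coord_mat \<iota> xs ` E"
      using zero by (auto simp: module_mat_simps coord_mat_zero[of n, symmetric])
    show "v \<oplus>\<^bsub>M.V\<^esub> w \<in> coord_mat \<iota> xs ` E"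
      if "v \<in> coord_mat \<iota> xs ` E" "w \<in> coord_mat \<iota> xs ` E" for v w
      using that dim add by (auto simp: module_mat_simps coord_mat_add[symmetric])
    show "k \<odot>\<^bsub>M.V\<^esub> v \<in> coord_mat \<iota> xs ` E" if "v \<in> coord_mat \<iota> xs ` E" for k v
      using that scale by (auto simp: module_mat_simps coord_mat_smult[symmetric])
  qed
  then show ?thesis
    by (intro subspace.intro M.vectorspace_axioms)
qed

end

lemma dim_eq_of_card_subspace:
  fixes C :: "'q::{field,finite} mat set"
  assumes C: "VectorSpace.subspace class_ring C (module_mat TYPE('q) m n)"
    and "finite C" "card C = CARD('q) ^ k"
  shows "vectorspace.dim class_ring ((module_mat TYPE('q) m n)\<lparr>carrier := C\<rparr>) = k"
proof -
  interpret M: matrix_vs m n "TYPE('q)" .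
  interpret W: vectorspace class_ring "M.V\<lparr>carrier := C\<rparr>"
    by (rule M.subspace_is_vs) (rule C)
  show ?thesis
    using W.card_carrier_eq_power_dim assms one_less_card_field[where 'a = 'q] by simp
qed

text \<open>The product is the combination of the rows of \<open>G\<close> with coefficients
  \<open>u\<close>; the partial sums \<open>s k\<close> over the first \<open>k\<close> rows stay in
  \<open>D\<close>.\<close>

lemma transpose_mult_vec_mem:
  fixes G :: "'l::field mat"
  assumes D: "VectorSpace.subspace class_ring D (module_vec TYPE('l) n)"
    and G: "G \<in> carrier_mat l n" and rows: "set (rows G) \<subseteq> D" and u: "u \<in> carrier_vec l"
  shows "G\<^sup>T *\<^sub>v u \<in> D"
proof -
  interpret V: vec_space "TYPE('l)" n .
  interpret D: submodule class_ring D V.V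
    using D by (rule subspace.submod)
  define s where "s k = vec n (\<lambda>j. \<Sum>i<k. u $ i * G $$ (i, j))" for k
  have "s k \<in> D" if "k \<le> l" for k
    using that
  proof (induction k)
    case 0
    have "s 0 = 0\<^sub>v n" by (auto simp: s_def)
    then show ?case using D.zero_closed by (simp add: module_vec_simps)
  next
    case (Suc k)
    have "row G k \<in> D"
      using Suc.prems G rows by (auto simp: rows_def)
    then have "s k + u $ k \<cdot>\<^sub>v row G k \<in> D"
      using Suc D.m_closed[of "s k" "u $ k \<cdot>\<^sub>v row G k"] D.smult_closed[of "u $ k" "row G k"]
      by (simp add: module_vec_simps)
    also have "s k + u $ k \<cdot>\<^sub>v row G k = s (Suc k)"
      using Suc.prems G by (intro eq_vecI) (auto simp: s_def)
    finally show ?case .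
  qed
  moreover have "G\<^sup>T *\<^sub>v u = s l"
    using G u
    by (intro eq_vecI) (auto simp: s_def scalar_prod_def atLeast0LessThan mult.commute intro!: sum.cong)
  ultimately show ?thesis by simp
qed

text \<open>The block matrix with empty lower blocks is \<open>(I | A)\<close>. The message
  reappears in the first \<open>l\<close> positions, which later gives both injectivity of the
  encoding and the support of these columns.\<close>

lemma systematic_transpose_mult_vec:
  fixes A :: "'l::comm_ring_1 mat"
  assumes A: "A \<in> carrier_mat l (n - l)" and "l \<le> n" and u: "u \<in> carrier_vec l" and "j < n"
  shows "((four_block_mat (1\<^sub>m l) A (0\<^sub>m 0 l) (0\<^sub>m 0 (n - l)))\<^sup>T *\<^sub>v u) $ j =
    (if j < l then u $ j else \<Sum>t<l. A $$ (t, j - l) * u $ t)"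
proof -
  let ?G = "four_block_mat (1\<^sub>m l) A (0\<^sub>m 0 l) (0\<^sub>m 0 (n - l))"
  have entry: "?G $$ (t, j) = (if j < l then (if t = j then 1 else 0) else A $$ (t, j - l))"
    if "t < l" for t
    using that assms by auto
  have "(?G\<^sup>T *\<^sub>v u) $ j = (\<Sum>t<l. ?G $$ (t, j) * u $ t)"
    using assms by (simp add: scalar_prod_def atLeast0LessThan)
  also have "\<dots> = (\<Sum>t<l. (if j < l then (if t = j then 1 else 0) else A $$ (t, j - l)) * u $ t)"
    by (intro sum.cong refl) (simp only: entry lessThan_iff)
  also have "\<dots> = (if j < l then u $ j else \<Sum>t<l. A $$ (t, j - l) * u $ t)"
    by (cases "j < l") (simp_all add: if_distrib[of "\<lambda>x. x * _"] cong: if_cong)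
  finally show ?thesis .
qed

lemma finite_carrier_vec: "finite (carrier_vec n :: 'l::finite vec set)"
proof (rule finite_subset)
  define S :: "(nat \<Rightarrow> 'l) set" where "S = {..<n} \<rightarrow>\<^sub>E UNIV"
  show "carrier_vec n \<subseteq> vec n ` S"
  proof
    fix v :: "'l vec" assume v: "v \<in> carrier_vec n"
    have "vec n (restrict (($) v) {..<n}) \<in> vec n ` S"
      unfolding S_def by (intro imageI restrict_PiE_iff[THEN iffD2] ballI UNIV_I)
    moreover have "vec n (restrict (($) v) {..<n}) = v"
      using v by (intro eq_vecI) auto
    ultimately show "v \<in> vec n ` S" by (simp only:)
  qed
  show "finite (vec n ` S)"
    unfolding S_def by (intro finite_imageI finite_PiE) simp_all
qed

subsection \<open>Existence of maximal codes\<close>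

theorem theorem3p6:
  fixes \<iota> :: "'q::{field,finite} \<Rightarrow> 'l::{field,finite}"
    and m n \<delta> l :: nat
    and F :: "(nat \<times> nat) set"
    and \<epsilon> :: int
    and A G :: "'l mat"
    and D :: "'l vec set"
  assumes "field_hom \<iota>" and "CARD('l) = CARD('q) ^ m"
    and "n \<le> m" and "ferrers_diagram m n F"
    and "2 \<le> \<delta>" and "\<delta> \<le> n" and "l = n - \<delta> + 1"
    and "\<epsilon> = (\<Sum>t = l + 1..n. int m - int (col_size F t))"
    and "\<forall>t\<in>{1..l}.
      int (col_size F t) \<le> int (col_size F (l + 1)) - \<epsilon> * (int l + 1 - int t)"
    and "A \<in> carrier_mat l (n - l)"
    and "G = four_block_mat (1\<^sub>m l) A (0\<^sub>m 0 l) (0\<^sub>m 0 (n - l))"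
    and "linear_mrd_code \<iota> m n \<delta> D" and "generator_matrix n G D"
  shows "(\<exists>xs. length xs = m \<and> ext_basis \<iota> xs \<and>
            maximal_ferrers_code m n F \<delta>
              {coord_mat \<iota> xs (G\<^sup>T *\<^sub>v u) | u.
                 u \<in> carrier_vec l \<and>
                 (\<forall>t\<in>{1..l}. u $ (t - 1) \<in> ext_span \<iota> (set (take (col_size F t) xs)))}) \<and>
         nu_min n F \<delta> = nu n F \<delta> 0 \<and>
         nu n F \<delta> 0 = (\<Sum>t = 1..l. col_size F t)"
proof -

  \<comment> \<open>The adapted basis and the encoding of messages\<close>
  interpret finite_field_ext \<iota>
    by (rule finite_field_ext.intro) fact
  define c where "c = col_size F"
  note F = \<open>ferrers_diagram m n F\<close>
  have c_le: "c t \<le> m" for t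
    unfolding c_def using F by (rule col_size_le)
  have c_mono: "c i \<le> c j" if "i \<le> j" "j \<le> n" for i j
    unfolding c_def using F that by (rule col_size_mono)
  have l: "1 \<le> l" "l < n" "n - l + 1 = \<delta>"
    using assms by auto
  \<comment> \<open>No summand is negative, as \<open>c t \<le> m\<close>; so the integer hypothesis
    can be restated over the naturals without truncation.\<close>
  have \<epsilon>: "\<epsilon> = int (\<Sum>t = l + 1..n. m - c t)"
    using c_le by (simp add: assms c_def of_nat_diff)
  have gap: "c t + (l + 1 - t) * (\<Sum>j = l + 1..n. m - c j) \<le> c (l + 1)" if t: "t \<in> {1..l}" for t
  proof -
    have "int (c t) \<le> int (c (l + 1)) - \<epsilon> * (int l + 1 - int t)"
      using assms(9) t unfolding c_def by blast
    also have "int l + 1 - int t = int (l + 1 - t)"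
      using t by (simp add: of_nat_diff)
    finally have "int (c t) + int (l + 1 - t) * \<epsilon> \<le> int (c (l + 1))"
      by (simp add: mult.commute)
    then show ?thesis
      unfolding \<epsilon> of_nat_mult[symmetric] of_nat_add[symmetric] of_nat_le_iff .
  qed
  \<comment> \<open>Rows \<open>t\<close> and columns \<open>j\<close> are counted from 1 here, and
    column \<open>j\<close> of \<open>G\<close> with \<open>j > l\<close> is column
    \<open>j - 1 - l\<close> of \<open>A\<close> counted from 0.\<close>
  obtain xs where xs: "length xs = m" "ext_basis \<iota> xs"
    and flag: "\<And>t j u. t \<in> {1..l} \<Longrightarrow> j \<in> {l + 1..n} \<Longrightarrow> u \<in> ext_span \<iota> (set (take (c t) xs)) \<Longrightarrow>
       A $$ (t - 1, j - 1 - l) * u \<in> ext_span \<iota> (set (take (c j) xs))"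
    using adapted_flag[OF assms(2) l(2) c_mono c_le gap,
        where a = "\<lambda>t j. A $$ (t - 1, j - 1 - l)"] by auto
  interpret finite_field_ext_basis \<iota> xs m
    by unfold_locales (fact xs)+
  define X where "X t = ext_span \<iota> (set (take (c t) xs))" for t
  have X: "E.subspace (X t)" for t
    by (simp add: X_def ext_span_def)
  define U where "U = {u \<in> carrier_vec l. \<forall>t\<in>{1..l}. u $ (t - 1) \<in> X t}"
  define w where "w u = G\<^sup>T *\<^sub>v u" for u
  define C where "C = coord_mat \<iota> xs ` w ` U"
  have G: "G \<in> carrier_mat l n"
    using assms(10) l(2) unfolding assms(11) by auto
  have w_carrier: "w u \<in> carrier_vec n" for u
    using G by (intro carrier_vecI) (simp add: w_def)
  have w_index: "w u $ j = (if j < l then u $ j else \<Sum>t<l. A $$ (t, j - l) * u $ t)"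
    if "u \<in> U" "j < n" for u j
    unfolding w_def assms(11) using that l(2) assms(10)
    by (intro systematic_transpose_mult_vec) (simp_all add: U_def)
  have U_index: "u $ t \<in> X (t + 1)" if "u \<in> U" "t < l" for u t
    using that unfolding U_def by (auto dest!: bspec[of _ _ "t + 1"])
  have UI: "u \<in> U" if "u \<in> carrier_vec l" "\<And>t. t < l \<Longrightarrow> u $ t \<in> X (t + 1)" for u
    unfolding U_def
  proof (intro CollectI conjI ballI that(1))
    fix t assume "t \<in> {1..l}"
    then show "u $ (t - 1) \<in> X t"
      using that(2)[of "t - 1"] by (cases t) auto
  qed
  \<comment> \<open>An entry before position \<open>l\<close> is a message symbol; a later one is a
    sum of products that \<open>flag\<close> places in the span for that column.\<close>
  have w_supp: "w u $ t \<in> X (t + 1)" if "u \<in> U" "t < n" for u t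
  proof (cases "t < l")
    case True
    then show ?thesis using that U_index by (simp add: w_index)
  next
    case False
    have "A $$ (s, t - l) * u $ s \<in> X (t + 1)" if "s < l" for s
      using flag[of "s + 1" "t + 1" "u $ s"] that False \<open>t < n\<close> U_index[OF \<open>u \<in> U\<close> that]
      by (simp add: X_def)
    then have "(\<Sum>s<l. A $$ (s, t - l) * u $ s) \<in> X (t + 1)"
      by (intro E.subspace_sum X) simp
    then show ?thesis using that False by (simp add: w_index)
  qed

  \<comment> \<open>Linearity and injectivity of the encoding\<close>
  have U_dim: "dim_vec u = l" if "u \<in> U" for u
    using that by (auto simp: U_def)
  have w_dim [simp]: "dim_vec (w u) = n" for u
    using w_carrier by (rule carrier_vecD)
  have U_zero: "0\<^sub>v l \<in> U"
    by (rule UI) (simp_all add: E.subspace_0[OF X])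
  have U_add: "u + v \<in> U" if "u \<in> U" "v \<in> U" for u v
    using that U_index E.subspace_add[OF X] by (intro UI) (auto simp: U_def)
  have U_scale: "\<iota> k \<cdot>\<^sub>v u \<in> U" if "u \<in> U" for u k
    using that U_index E.subspace_scale[OF X, of _ _ k]
    by (intro UI) (auto simp: U_def ext_scale_def)
  have U_diff: "u - v \<in> U" if "u \<in> U" "v \<in> U" for u v
    using that U_index E.subspace_diff[OF X] by (intro UI) (auto simp: U_def)
  have U_carrier: "U \<subseteq> carrier_vec l"
    by (auto simp: U_def)
  have w_zero: "w (0\<^sub>v l) = 0\<^sub>v n"
    using G by (intro eq_vecI) (auto simp: w_def scalar_prod_def)
  have w_add: "w (u + v) = w u + w v" if "u \<in> U" "v \<in> U" for u v
    using that U_carrier G by (auto simp: w_def intro!: mult_add_distrib_mat_vec)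
  have w_diff: "w (u - v) = w u - w v" if "u \<in> U" "v \<in> U" for u v
    using that U_carrier G by (auto simp: w_def intro!: mult_minus_distrib_mat_vec)
  have w_scale: "w (k \<cdot>\<^sub>v u) = k \<cdot>\<^sub>v w u" if "u \<in> U" for u k
    using that U_carrier G by (auto simp: w_def intro!: mult_mat_vec)
  have w_inj: "inj_on w U"
  proof (rule inj_onI)
    fix u v assume u: "u \<in> U" and v: "v \<in> U" and eq: "w u = w v"
    have "u $ t = v $ t" if "t < l" for t
      using w_index[OF u, of t] w_index[OF v, of t] that l(2) by (simp add: eq)
    then show "u = v"
      by (intro eq_vecI) (simp_all add: U_dim u v)
  qed

  \<comment> \<open>Lower bound on the rank from the MRD code\<close>
  have D: "VectorSpace.subspace class_ring D (module_vec TYPE('l) n)"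
    and mrd: "has_rank_distance (vec_rank \<iota>) (0\<^sub>v n) D \<delta>"
    using assms(12) by (auto simp: linear_mrd_code_def mrd_code_def)
  interpret V: vec_space "TYPE('l)" n .
  have "vectorspace class_ring (V.V\<lparr>carrier := D\<rparr>)"
    using D by (rule V.subspace_is_vs)
  then have rows: "set (rows G) \<subseteq> D"
    using assms(13) by (auto simp: generator_matrix_def vectorspace.basis_def)
  have D_carrier: "D \<subseteq> carrier_vec n"
    using submodule.subset[OF subspace.submod[OF D]] by (simp add: module_vec_simps)
  have w_D: "w u \<in> D" if "u \<in> U" for u
    unfolding w_def using D G rows that U_carrier by (intro transpose_mult_vec_mem) auto
  have rank_ge: "\<delta> \<le> vec_rank \<iota> a" if "a \<in> w ` U" "a \<noteq> 0\<^sub>v n" for a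
  proof -
    have "finite D"
      using D_carrier finite_carrier_vec by (rule finite_subset)
    moreover have "a \<in> D"
      using that w_D by auto
    ultimately have "Min (vec_rank \<iota> ` (D - {0\<^sub>v n})) \<le> vec_rank \<iota> a"
      using that(2) by (intro Min_le) auto
    then show ?thesis
      using mrd by (simp add: has_rank_distance_def)
  qed

  \<comment> \<open>Number of codewords\<close>
  have inj_coord: "inj_on (coord_mat \<iota> xs) (w ` U)"
  proof (rule inj_onI)
    fix a b assume "a \<in> w ` U" "b \<in> w ` U" and eq: "coord_mat \<iota> xs a = coord_mat \<iota> xs b"
    then have "dim_vec a = dim_vec b"
      by auto
    then show "a = b"
      using eq by (rule coord_mat_inject)
  qed
  have "card U = (\<Prod>t<l. card (X (t + 1)))"
  proof -
    \<comment> \<open>Messages correspond to families that choose one element of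
      \<open>X (t + 1)\<close> for each \<open>t < l\<close>.\<close>
    have "inj_on (vec l) (\<Pi>\<^sub>E t\<in>{..<l}. X (t + 1))"
    proof (rule inj_onI)
      fix f g assume fg: "f \<in> (\<Pi>\<^sub>E t\<in>{..<l}. X (t + 1))" "g \<in> (\<Pi>\<^sub>E t\<in>{..<l}. X (t + 1))"
        and eq: "vec l f = vec l g"
      have "f t = g t" if "t \<in> {..<l}" for t
      proof -
        have "vec l f $ t = vec l g $ t"
          by (simp only: eq)
        then show ?thesis
          using that by simp
      qed
      with fg show "f = g" by (rule PiE_ext)
    qed
    moreover have "vec l ` (\<Pi>\<^sub>E t\<in>{..<l}. X (t + 1)) = U"
    proof (intro subset_antisym subsetI)
      fix u assume "u \<in> vec l ` (\<Pi>\<^sub>E t\<in>{..<l}. X (t + 1))"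
      then obtain f where f: "f \<in> (\<Pi>\<^sub>E t\<in>{..<l}. X (t + 1))" and u: "u = vec l f"
        by (rule imageE)
      have "f t \<in> X (t + 1)" if "t < l" for t
        using PiE_mem[OF f, of t] that by simp
      then show "u \<in> U"
        unfolding u by (intro UI) simp_all
    next
      fix u assume u: "u \<in> U"
      have "vec l (restrict (($) u) {..<l}) \<in> vec l ` (\<Pi>\<^sub>E t\<in>{..<l}. X (t + 1))"
        using U_index[OF u] by (intro imageI restrict_PiE_iff[THEN iffD2] ballI) simp
      moreover have "vec l (restrict (($) u) {..<l}) = u"
        by (intro eq_vecI) (simp_all add: U_dim[OF u])
      ultimately show "u \<in> vec l ` (\<Pi>\<^sub>E t\<in>{..<l}. X (t + 1))"
        by (simp only:)
    qed
    ultimately have "card U = card (\<Pi>\<^sub>E t\<in>{..<l}. X (t + 1))"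
      by (metis card_image)
    then show ?thesis by (simp add: card_PiE)
  qed
  also have "\<dots> = (\<Prod>t<l. CARD('q) ^ c (t + 1))"
    using c_le by (simp add: X_def card_span_take)
  also have "\<dots> = CARD('q) ^ (\<Sum>t<l. c (t + 1))"
    by (simp add: power_sum)
  also have "(\<Sum>t<l. c (t + 1)) = (\<Sum>t = 1..l. c t)"
    by (rule sum.reindex_bij_witness[of _ "\<lambda>t. t - 1" Suc]) auto
  finally have card_E: "card (w ` U) = CARD('q) ^ (\<Sum>t = 1..l. c t)"
    using w_inj by (simp add: card_image)
  have card_C: "card C = CARD('q) ^ (\<Sum>t = 1..l. c t)"
    unfolding C_def by (simp only: card_image[OF inj_coord] card_E)

  \<comment> \<open>The minimum of the bounds\<close>
  have nu_0: "nu n F \<delta> 0 = (\<Sum>t = 1..l. c t)"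
    using assms(7) by (simp add: nu_def c_def)
  \<comment> \<open>The code has q to the power \<open>nu n F \<delta> 0\<close> elements and, by
    the bound for \<open>j\<close>, at most q to the power \<open>nu n F \<delta> j\<close>; as q
    exceeds 1, the exponents compare.\<close>
  have nu_ge: "(\<Sum>t = 1..l. c t) \<le> nu n F \<delta> j" if "j < \<delta>" for j
  proof -
    have "card (w ` U) \<le> CARD('q) ^ nu n F \<delta> j"
      unfolding nu_def c_def[symmetric]
    proof (rule card_code_le)
      show "w ` U \<subseteq> carrier_vec n"
        using w_carrier by blast
      show "a - b \<in> w ` U" if "a \<in> w ` U" "b \<in> w ` U" for a b
        using that U_diff by (auto simp flip: w_diff)
      show "a $ t \<in> ext_span \<iota> (set (take (c (t + 1)) xs))" if "a \<in> w ` U" "t < n" for a t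
        using that w_supp by (auto simp: X_def)
    qed (use rank_ge c_le that assms(6) in auto)
    then show ?thesis
      using one_less_card_field[where 'a = 'q] by (simp add: card_E)
  qed
  have nu_min: "nu_min n F \<delta> = (\<Sum>t = 1..l. c t)"
    unfolding nu_min_def
  proof (rule Min_eqI)
    show "(\<Sum>t = 1..l. c t) \<in> nu n F \<delta> ` {0..<\<delta>}"
      using assms(5) by (intro image_eqI[of _ _ 0]) (simp_all add: nu_0)
  qed (use nu_ge in auto)

  \<comment> \<open>Support, rank distance and dimension of the matrix code\<close>
  have C_subspace: "VectorSpace.subspace class_ring C (module_mat TYPE('q) m n)"
    unfolding C_def
  proof (rule subspace_coord_mat_image)
    show "0\<^sub>v n \<in> w ` U"
      using U_zero w_zero by (metis imageI)
    show "a + b \<in> w ` U" if "a \<in> w ` U" "b \<in> w ` U" for a b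
      using that U_add by (auto simp flip: w_add)
    show "\<iota> k \<cdot>\<^sub>v a \<in> w ` U" if "a \<in> w ` U" for a k
      using that U_scale by (auto simp flip: w_scale)
  qed (use w_carrier in blast)
  have fin_U: "finite U"
    using U_carrier finite_carrier_vec by (rule finite_subset)
  have C_supp: "(i + 1, j + 1) \<in> F" if "M \<in> C" "i < m" "j < n" "M $$ (i, j) \<noteq> 0" for M i j
  proof -
    obtain u where u: "u \<in> U" "M = coord_mat \<iota> xs (w u)"
      using \<open>M \<in> C\<close> by (auto simp: C_def)
    have "coord (w u $ j) i \<noteq> 0"
      using that u(2) by simp
    then have "i < c (j + 1)"
      using w_supp[OF u(1) that(3)] that(2) by (auto simp: X_def span_take_iff not_le[symmetric])
    then show ?thesis
      using F by (simp add: ferrers_mem_iff c_def)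
  qed
  have C_rank: "has_rank_distance (vec_space.rank m) (0\<^sub>m m n) C \<delta> \<or>
      nu_min n F \<delta> = 0 \<and> C = {0\<^sub>m m n}"
  \<comment> \<open>If column \<open>l\<close> is empty, so are all columns before it, and only the
    zero code remains.\<close>
  proof (cases "c l = 0")
    case True
    then have "c t = 0" if "t \<in> {1..l}" for t
      using c_mono[of t l] that l(2) by simp
    then have "nu_min n F \<delta> = 0" "card C = 1"
      by (simp_all add: nu_min card_C)
    moreover have "0\<^sub>m m n \<in> C"
      using U_zero w_zero coord_mat_zero[of n] unfolding C_def by (metis imageI)
    ultimately show ?thesis
      by (auto simp: card_1_singleton_iff)
  next
    case False
    then have "0 < m"
      using c_le[of l] by simp
    \<comment> \<open>This message encodes to the first basis element times the last row of
      \<open>G\<close>; it is admissible since \<open>c l\<close> is positive. That row vanishes in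
      its first \<open>l - 1\<close> positions, which leaves \<open>n - l + 1 = \<delta>\<close>
      entries to span the rest.\<close>
    define u where "u = vec l (\<lambda>t. if t = l - 1 then xs ! 0 else 0)"
    have "xs ! 0 \<in> set (take (c l) xs)"
      using False \<open>0 < m\<close> by (auto simp: in_set_conv_nth intro!: exI[of _ 0])
    then have "xs ! 0 \<in> X l"
      unfolding X_def ext_span_def by (rule E.span_base)
    then have u: "u \<in> U"
      using l(1) E.subspace_0[OF X] by (intro UI) (auto simp: u_def)
    have "xs ! 0 \<noteq> 0"
      using independent_xs \<open>0 < m\<close> E.dependent_zero by (metis length_xs nth_mem)
    then have "w u $ (l - 1) \<noteq> 0"
      using l by (simp add: w_index[OF u]) (simp add: u_def)
    then have w0: "w u \<noteq> 0\<^sub>v n"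
      using l by auto
    have "w u $ j \<in> E.span (($) (w u) ` {l - 1..<n})" if "j < n" for j
    proof (cases "j < l - 1")
      case True
      then have "w u $ j = 0"
        using that l by (simp add: w_index[OF u]) (simp add: u_def)
      then show ?thesis by (simp add: E.span_zero)
    next
      case False
      then show ?thesis using that by (intro E.span_base) simp
    qed
    then have "vec_rank \<iota> (w u) \<le> card (($) (w u) ` {l - 1..<n})"
      by (intro vec_rank_le) simp_all
    also have "\<dots> \<le> card {l - 1..<n}"
      by (rule card_image_le) simp
    also have "\<dots> = \<delta>"
      using l by simp
    finally have rank_u: "vec_rank \<iota> (w u) = \<delta>"
      using rank_ge[of "w u"] u w0 by simp
    have nz: "coord_mat \<iota> xs a = 0\<^sub>m m n \<longleftrightarrow> a = 0\<^sub>v n" if "a \<in> w ` U" for a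
    proof -
      have "dim_vec a = n"
        using that by auto
      then show ?thesis
        using coord_mat_inject[of a "0\<^sub>v n"] coord_mat_zero[of n] by auto
    qed
    have "Min (vec_space.rank m ` (C - {0\<^sub>m m n})) = \<delta>"
    proof (rule Min_eqI)
      show "finite (vec_space.rank m ` (C - {0\<^sub>m m n}))"
        using fin_U by (simp add: C_def)
      show "\<delta> \<le> r" if "r \<in> vec_space.rank m ` (C - {0\<^sub>m m n})" for r
      proof -
        obtain a where a: "a \<in> w ` U" "r = vec_space.rank m (coord_mat \<iota> xs a)"
            "coord_mat \<iota> xs a \<noteq> 0\<^sub>m m n"
          using \<open>r \<in> _\<close> unfolding C_def by blast
        then show ?thesis
          using rank_ge[of a] nz[of a] by (simp add: rank_coord_mat)
      qed
      show "\<delta> \<in> vec_space.rank m ` (C - {0\<^sub>m m n})"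
      proof (rule image_eqI)
        show "\<delta> = vec_space.rank m (coord_mat \<iota> xs (w u))"
          by (simp add: rank_coord_mat rank_u)
        show "coord_mat \<iota> xs (w u) \<in> C - {0\<^sub>m m n}"
          using u w0 nz by (simp add: C_def)
      qed
    qed
    moreover have "C - {0\<^sub>m m n} \<noteq> {}"
      using u w0 nz[of "w u"] by (auto simp: C_def)
    ultimately show ?thesis
      by (simp add: has_rank_distance_def)
  qed
  have C_maximal: "maximal_ferrers_code m n F \<delta> C"
    unfolding maximal_ferrers_code_def ferrers_code_def
    using C_subspace C_supp C_rank fin_U card_C
    by (auto simp: nu_min C_def intro!: dim_eq_of_card_subspace)
  have C_eq: "C = {coord_mat \<iota> xs (G\<^sup>T *\<^sub>v u) | u. u \<in> carrier_vec l \<and>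
      (\<forall>t\<in>{1..l}. u $ (t - 1) \<in> ext_span \<iota> (set (take (col_size F t) xs)))}"
    by (auto simp: C_def U_def w_def X_def c_def)
  show ?thesis
  proof (intro conjI exI[of _ xs] xs)
    show "maximal_ferrers_code m n F \<delta> {coord_mat \<iota> xs (G\<^sup>T *\<^sub>v u) | u. u \<in> carrier_vec l \<and>
        (\<forall>t\<in>{1..l}. u $ (t - 1) \<in> ext_span \<iota> (set (take (col_size F t) xs)))}"
      using C_maximal unfolding C_eq .
    show "nu_min n F \<delta> = nu n F \<delta> 0"
      by (simp only: nu_min nu_0)
    show "nu n F \<delta> 0 = (\<Sum>t = 1..l. col_size F t)"
      by (simp only: nu_0 c_def)
  qed
qed

end
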